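(* For all $n$ we have $\theta(n)\leq n^{8/9+o(1)}$; that is, there is a function $f$ with $f(n)\to 0$ as $n\to\infty$ such that every graph on $n$ vertices has $\theta(G)\leq n^{8/9+f(n)}$.
   Context: An interval colouring of a graph $G=(V,E)$ is an edge-colouring $c\colon E\to\mathbb{Z}$ such that for every vertex $x$, the multiset of colours of edges incident to $x$ forms an interval of $\mathbb{Z}$. The interval thickness $\theta(G)$ is the smallest integer $k$ such that $E(G)$ can be partitioned into $k$ sets each inducing an interval colourable graph. $\theta(n)$ is the maximum of $\theta(G)$ over all graphs $G$ on $n$ vertices. *)

theory Defs
  imports Complex_Main "HOL-Library.Multiset" "HOL-Library.Disjoint_Sets" "HOL-Library.Ramsey"
begin

text \<open>Finite simple graphs: edges are 2-element subsets of the vertex set.\<close>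

definition simple_graph :: "'a set \<Rightarrow> 'a set set \<Rightarrow> bool" where
  "simple_graph V E \<longleftrightarrow> finite V \<and> E \<subseteq> nsets V 2"

text \<open>The condition is on the multiset of colours at a vertex, so an interval colouring is in
  particular a proper edge-colouring. The empty interval (\<open>b < a\<close>) occurs at isolated vertices.\<close>

definition interval_colouring :: "'a set \<Rightarrow> 'a set set \<Rightarrow> ('a set \<Rightarrow> int) \<Rightarrow> bool" where
  "interval_colouring V E c \<longleftrightarrow>
     (\<forall>x\<in>V. \<exists>a b. image_mset c (mset_set {e \<in> E. x \<in> e}) = mset_set {a..b})"

definition interval_colourable :: "'a set \<Rightarrow> 'a set set \<Rightarrow> bool" where
  "interval_colourable V E \<longleftrightarrow> (\<exists>c. interval_colouring V E c)"

text \<open>The graph induced by an edge set \<open>F\<close> has vertex set \<open>\<Union>F\<close>. The parts of a partition are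
  nonempty, so a graph without edges has thickness 0.\<close>

definition interval_thickness :: "'a set \<Rightarrow> 'a set set \<Rightarrow> nat" where
  "interval_thickness V E =
     (LEAST k. \<exists>P. partition_on E P \<and> card P = k \<and> (\<forall>F\<in>P. interval_colourable (\<Union>F) F))"

text \<open>Every finite graph is isomorphic to one whose vertices are natural numbers. The set below is
  nonempty, and finite because single edges are interval colourable, so that the thickness is at
  most \<open>n choose 2\<close>.\<close>

definition max_interval_thickness :: "nat \<Rightarrow> nat" where
  "max_interval_thickness n =
     Max {interval_thickness V E | (V :: nat set) E. simple_graph V E \<and> card V = n}"

end

theory Submission imports Defs begin

text \<open>
  A union of matchings \<open>M\<^sub>0, M\<^sub>1, \<dots>\<close> whose vertex sets are nested decreasingly is interval
  colourable: give \<open>M\<^sub>i\<close> the colour \<open>i\<close>, so that every vertex sees an initial segment of the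
  colours. Let a bipartite graph have sides \<open>A\<close> and \<open>B\<close> with \<open>card B \<le> card A\<close> and all degrees in
  \<open>A\<close> at least \<open>d > 0\<close>. By Hall's theorem, a minimal nonempty \<open>A' \<subseteq> A\<close> with at most \<open>card A'\<close>
  neighbours is perfectly matched to its neighbourhood. Passing to \<open>A'\<close> and its neighbourhood and
  deleting this matching lowers the degrees in \<open>A'\<close> by exactly one, so the step can be repeated
  \<open>d\<close> times. The resulting nested matchings have at least
  \<open>d + (d - 1) + \<dots> + 1 \<ge> d\<^sup>2 / 2\<close> edges.

  A graph that is not \<open>2 d\<close>-degenerate contains such a bipartite graph (take a maximum cut of a
  subgraph of large minimum degree). Removing interval colourable subgraphs with \<open>d\<^sup>2 / 2\<close> edges as
  long as possible takes at most \<open>n\<^sup>2 / d\<^sup>2\<close> steps and leaves a \<open>2 d\<close>-degenerate graph, which is a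
  union of \<open>2 d\<close> forests. With \<open>d\<close> about \<open>n powr (2/3)\<close> this even gives the bound
  \<open>5 * n powr (2/3)\<close>.
\<close>

section \<open>Interval colourable edge sets and decompositions into them\<close>

text \<open>A bijection onto \<open>{a..b}\<close> in place of an equation of multisets reduces
  colour arguments to \<open>bij_betw\<close> rules. Since \<open>x\<close> ranges over the whole
  type, no vertex set has to be carried along: a point on no edge gets an empty interval.\<close>

definition icol :: "'a set set \<Rightarrow> bool" where
  "icol E \<longleftrightarrow> (\<exists>c :: 'a set \<Rightarrow> int. \<forall>x. \<exists>a b. bij_betw c {e \<in> E. x \<in> e} {a..b})"

text \<open>A labelling stands in for a partition because its classes may be empty, so that
  \<open>k\<close> can be any upper bound.\<close>

definition decomposable :: "'a set set \<Rightarrow> nat \<Rightarrow> bool" where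
  "decomposable E k \<longleftrightarrow> (\<exists>g :: 'a set \<Rightarrow> nat. g ` E \<subseteq> {..<k} \<and> (\<forall>i. icol {e \<in> E. g e = i}))"

lemma icol_empty: "icol {}"
proof -
  have "\<forall>x. \<exists>a b. bij_betw (\<lambda>_. 0) {e \<in> {} :: 'a set set. x \<in> e} {a..b :: int}"
    by (intro allI exI[of _ 1] exI[of _ 0]) (simp add: bij_betw_def)
  then show ?thesis unfolding icol_def by blast
qed

lemma interval_colourable_if_icol:
  assumes "icol E"
  shows "interval_colourable V E"
proof -
  obtain c :: "'a set \<Rightarrow> int" where c: "\<And>x. \<exists>a b. bij_betw c {e \<in> E. x \<in> e} {a..b}"
    using assms unfolding icol_def by auto
  have "\<exists>a b. image_mset c (mset_set {e \<in> E. x \<in> e}) = mset_set {a..b}" for x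
    using c[of x] by (metis bij_betw_def image_mset_mset_set)
  then show ?thesis
    unfolding interval_colourable_def interval_colouring_def by blast
qed

lemma interval_thickness_le:
  assumes "decomposable E k"
  shows "interval_thickness V E \<le> k"
proof -
  obtain g :: "'a set \<Rightarrow> nat" where g: "g ` E \<subseteq> {..<k}" "\<And>i. icol {e \<in> E. g e = i}"
    using assms unfolding decomposable_def by auto
  \<comment> \<open>Parts of a partition are nonempty, so the empty label class is discarded; this
    can only lower the number of parts.\<close>
  define P where "P = (\<lambda>i. {e \<in> E. g e = i}) ` {..<k} - {{}}"
  have "partition_on E P"
  proof (rule partition_onI)
    show "\<Union>P = E" unfolding P_def using g(1) by auto
    show "disjnt p q" if "p \<in> P" "q \<in> P" "p \<noteq> q" for p q
      using that unfolding P_def disjnt_def by auto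
    show "{} \<notin> P" unfolding P_def by auto
  qed
  moreover have "\<forall>F\<in>P. interval_colourable (\<Union>F) F"
    using g(2) interval_colourable_if_icol unfolding P_def by auto
  ultimately have "interval_thickness V E \<le> card P"
    unfolding interval_thickness_def by (intro Least_le) auto
  also have "card P \<le> card ((\<lambda>i. {e \<in> E. g e = i}) ` {..<k})"
    unfolding P_def by (intro card_mono) auto
  also have "\<dots> \<le> k"
    using card_image_le[of "{..<k}" "\<lambda>i. {e \<in> E. g e = i}"] by simp
  finally show ?thesis .
qed

lemma decomposable_Un:
  assumes "decomposable E k" "icol F" "E \<inter> F = {}"
  shows "decomposable (E \<union> F) (Suc k)"
proof -
  obtain g :: "'a set \<Rightarrow> nat" where g: "g ` E \<subseteq> {..<k}" "\<And>i. icol {e \<in> E. g e = i}"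
    using assms(1) unfolding decomposable_def by auto
  define h where "h e = (if e \<in> F then k else g e)" for e
  have "icol {e \<in> E \<union> F. h e = i}" for i
  proof (cases "i = k")
    case True
    then have "{e \<in> E \<union> F. h e = i} = F"
      using g(1) by (auto simp: h_def split: if_splits)
    then show ?thesis using assms(2) by simp
  next
    case False
    then have "{e \<in> E \<union> F. h e = i} = {e \<in> E. g e = i}"
      using assms(3) by (auto simp: h_def split: if_splits)
    then show ?thesis using g(2) by simp
  qed
  moreover have "h ` (E \<union> F) \<subseteq> {..<Suc k}"
    using g(1) by (auto simp: h_def less_Suc_eq)
  ultimately show ?thesis unfolding decomposable_def by blast
qed

section \<open>Degenerate graphs\<close>

text \<open>The colour \<open>b + 1\<close> prolongs the interval \<open>{a..b}\<close> at
  \<open>u\<close> by one, and it is the only colour at \<open>v\<close>.\<close>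

lemma icol_insert_pendant:
  assumes "icol E" "v \<notin> \<Union>E" "u \<noteq> v"
  shows "icol (insert {u, v} E)"
proof -
  obtain c :: "'a set \<Rightarrow> int" where c: "\<And>x. \<exists>a b. bij_betw c {e \<in> E. x \<in> e} {a..b}"
    using assms(1) unfolding icol_def by auto
  obtain a b where ab: "bij_betw c {e \<in> E. u \<in> e} {a..b}"
    using c by blast
  define d where "d = c({u, v} := b + 1)"
  have notin: "{u, v} \<notin> E" using assms(2) by auto
  have d_eq: "bij_betw d {e \<in> E. x \<in> e} I \<longleftrightarrow> bij_betw c {e \<in> E. x \<in> e} I" for x I
    by (rule bij_betw_cong) (use notin in \<open>auto simp: d_def\<close>)
  have "\<exists>a b. bij_betw d {e \<in> insert {u, v} E. x \<in> e} {a..b}" for x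
  proof -
    consider "x = u" | "x = v" | "x \<noteq> u" "x \<noteq> v" by blast
    then show ?thesis
    proof cases
      case 1
      have "bij_betw d ({e \<in> E. u \<in> e} \<union> {{u, v}}) ({a..b} \<union> {b + 1})"
        by (rule bij_betw_combine) (use ab d_eq in \<open>auto simp: d_def\<close>)
      moreover have "{e \<in> insert {u, v} E. x \<in> e} = {e \<in> E. u \<in> e} \<union> {{u, v}}"
        using 1 by auto
      \<comment> \<open>If \<open>b < a\<close>, then \<open>u\<close> meets no edge of
        \<open>E\<close>, and its interval starts afresh at \<open>b + 1\<close>.\<close>
      moreover obtain a' where "{a..b} \<union> {b + 1} = {a'..b + 1}"
      proof (cases "a \<le> b")
        case True
        then have "{a..b} \<union> {b + 1} = {a..b + 1}" by auto
        then show ?thesis by (rule that)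
      next
        case False
        then have "{a..b} \<union> {b + 1} = {b + 1..b + 1}" by auto
        then show ?thesis by (rule that)
      qed
      ultimately have "bij_betw d {e \<in> insert {u, v} E. x \<in> e} {a'..b + 1}" by simp
      then show ?thesis by blast
    next
      case 2
      have "{e \<in> insert {u, v} E. x \<in> e} = {{u, v}}"
        using 2 assms(2) by auto
      then have "bij_betw d {e \<in> insert {u, v} E. x \<in> e} {b + 1..b + 1}"
        by (simp add: d_def bij_betw_def)
      then show ?thesis by blast
    next
      case 3
      then have "{e \<in> insert {u, v} E. x \<in> e} = {e \<in> E. x \<in> e}" by auto
      then show ?thesis using c[of x] d_eq by auto
    qed
  qed
  then show ?thesis unfolding icol_def by blast
qed

text \<open>Delete a vertex \<open>w\<close> of degree at most \<open>k\<close> and decompose the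
  rest. The edges at \<open>w\<close> get distinct labels, so each class gains at most one edge,
  which is pendant at \<open>w\<close>.\<close>

lemma decomposable_if_degenerate:
  assumes "finite V" "E \<subseteq> nsets V 2"
    and "\<And>W. W \<subseteq> V \<Longrightarrow> W \<noteq> {} \<Longrightarrow> \<exists>w\<in>W. card {e \<in> E. e \<subseteq> W \<and> w \<in> e} \<le> k"
  shows "decomposable E k"
  using assms
proof (induction V arbitrary: E rule: finite_psubset_induct)
  case (psubset V)
  have finE: "finite E"
    using psubset.hyps psubset.prems(1) by (meson finite_imp_finite_nsets finite_subset)
  show ?case
  proof (cases "V = {}")
    case True
    then have "E = {}" using psubset.prems(1) by (auto simp: nsets_def)
    then show ?thesis by (auto simp: decomposable_def icol_empty)
  next
    case False
    then obtain w where w: "w \<in> V" "card {e \<in> E. e \<subseteq> V \<and> w \<in> e} \<le> k"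
      using psubset.prems(2) by blast
    define D where "D = {e \<in> E. w \<in> e}"
    define E' where "E' = {e \<in> E. w \<notin> e}"
    have "{e \<in> E. e \<subseteq> V \<and> w \<in> e} = D"
      using psubset.prems(1) by (auto simp: D_def nsets_def)
    with w have "card D \<le> card {..<k}" by simp
    then obtain h where h: "h ` D \<subseteq> {..<k}" "inj_on h D"
      using card_le_inj[of D "{..<k}"] finE by (auto simp: D_def)
    have "decomposable E' k"
    proof (rule psubset.IH)
      show "V - {w} \<subset> V" using w by auto
      show "E' \<subseteq> nsets (V - {w}) 2"
        using psubset.prems(1) by (auto simp: E'_def nsets_def)
      fix W assume W: "W \<subseteq> V - {w}" "W \<noteq> {}"
      then obtain z where z: "z \<in> W" "card {e \<in> E. e \<subseteq> W \<and> z \<in> e} \<le> k"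
        using psubset.prems(2)[of W] by blast
      have "{e \<in> E'. e \<subseteq> W \<and> z \<in> e} = {e \<in> E. e \<subseteq> W \<and> z \<in> e}"
        using W by (auto simp: E'_def)
      with z(2) have "card {e \<in> E'. e \<subseteq> W \<and> z \<in> e} \<le> k" by simp
      with z(1) show "\<exists>w\<in>W. card {e \<in> E'. e \<subseteq> W \<and> w \<in> e} \<le> k" by (rule bexI[rotated])
    qed
    then obtain g :: "'a set \<Rightarrow> nat"
      where g: "g ` E' \<subseteq> {..<k}" "\<And>i. icol {e \<in> E'. g e = i}"
      unfolding decomposable_def by auto
    define g' where "g' e = (if w \<in> e then h e else g e)" for e
    have "icol {e \<in> E. g' e = i}" for i
    proof (cases "\<exists>d\<in>D. h d = i")
      case True
      then obtain d where d: "d \<in> D" "h d = i" by blast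
      then have "card d = 2" "w \<in> d"
        using psubset.prems(1) by (auto simp: D_def nsets_def)
      then obtain u where u: "d = {u, w}" "u \<noteq> w"
        by (auto simp: card_2_iff)
      have "{e \<in> E. g' e = i} = insert d {e \<in> E'. g e = i}"
        using d h(2) by (auto simp: g'_def E'_def D_def inj_on_def)
      then show ?thesis
        using icol_insert_pendant[OF g(2)[of i], of w u] u by (auto simp: E'_def)
    next
      case False
      then have "{e \<in> E. g' e = i} = {e \<in> E'. g e = i}"
        by (auto simp: g'_def E'_def D_def)
      then show ?thesis using g by simp
    qed
    moreover have "g' ` E \<subseteq> {..<k}"
      using g(1) h(1) by (auto simp: g'_def E'_def D_def)
    ultimately show ?thesis unfolding decomposable_def by blast
  qed
qed

section \<open>Hall's theorem and perfectly matched subsets\<close>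

text \<open>If all nonempty proper subsets have a surplus of neighbours, any single pair can be
  matched first. Otherwise some tight \<open>S\<close> exists, and \<open>S\<close> and
  \<open>A - S\<close> are matched separately, the latter outside the neighbourhood of
  \<open>S\<close>.\<close>

lemma hall_marriage:
  assumes "finite A" "finite R" "\<And>S. S \<subseteq> A \<Longrightarrow> card S \<le> card (R `` S)"
  shows "\<exists>f. inj_on f A \<and> (\<forall>x\<in>A. (x, f x) \<in> R)"
  using assms
proof (induction A arbitrary: R rule: finite_psubset_induct)
  case (psubset A)
  have finI: "finite (R `` S)" for S
    using psubset.prems(1) by (rule finite_Image)
  consider "A = {}" | "A \<noteq> {}" "\<And>S. S \<subset> A \<Longrightarrow> S \<noteq> {} \<Longrightarrow> card S < card (R `` S)"
    | S where "S \<subset> A" "S \<noteq> {}" "card (R `` S) \<le> card S"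
    by (meson not_less)
  then show ?case
  proof cases
    case 1
    then show ?thesis by simp
  next
    case 2
    then obtain x where x: "x \<in> A" by blast
    then have "card (R `` {x}) \<ge> 1" using psubset.prems(2)[of "{x}"] by simp
    then obtain y where y: "(x, y) \<in> R"
      by (metis Image_singleton_iff card.empty equals0I not_one_le_zero)
    define R' where "R' = R - UNIV \<times> {y}"
    have "\<exists>f. inj_on f (A - {x}) \<and> (\<forall>x\<in>A - {x}. (x, f x) \<in> R')"
    proof (rule psubset.IH)
      show "A - {x} \<subset> A" using x by auto
      show "finite R'" unfolding R'_def using psubset.prems(1) by simp
      fix S assume S: "S \<subseteq> A - {x}"
      have "R' `` S = R `` S - {y}" unfolding R'_def by auto
      then have "card (R `` S) - 1 \<le> card (R' `` S)"
        using finI[of S] by (simp add: card_Diff_singleton_if)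
      \<comment> \<open>Deleting \<open>y\<close> costs at most one neighbour, which the surplus of
        the proper subset \<open>S\<close> pays for.\<close>
      moreover have "card S < card (R `` S)" if "S \<noteq> {}"
        using 2(2)[of S] that S x by blast
      ultimately show "card S \<le> card (R' `` S)" by (cases "S = {}") auto
    qed
    then obtain f where f: "inj_on f (A - {x})" "\<And>z. z \<in> A - {x} \<Longrightarrow> (z, f z) \<in> R'" by blast
    have "inj_on (f(x := y)) A"
      using f unfolding inj_on_def R'_def by auto
    moreover have "\<forall>z\<in>A. (z, (f(x := y)) z) \<in> R"
      using f(2) y unfolding R'_def by auto
    ultimately show ?thesis by blast
  next
    case 3
    have "\<exists>f. inj_on f S \<and> (\<forall>x\<in>S. (x, f x) \<in> R)"
      by (rule psubset.IH) (use 3 psubset.prems in auto)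
    then obtain f1 where f1: "inj_on f1 S" "\<And>x. x \<in> S \<Longrightarrow> (x, f1 x) \<in> R" by blast
    define R' where "R' = R - UNIV \<times> (R `` S)"
    have "\<exists>f. inj_on f (A - S) \<and> (\<forall>x\<in>A - S. (x, f x) \<in> R')"
    proof (rule psubset.IH)
      show "A - S \<subset> A" using 3 by auto
      show "finite R'" unfolding R'_def using psubset.prems(1) by simp
      fix T assume T: "T \<subseteq> A - S"
      have fin: "finite S" "finite T"
        using psubset.hyps 3(1) T by (auto intro: finite_subset)
      \<comment> \<open>Hall's condition for \<open>T \<union> S\<close>, minus the tight set
        \<open>S\<close>, leaves Hall's condition for \<open>T\<close> in \<open>R'\<close>.\<close>
      have "card T + card S = card (T \<union> S)"
        using T fin by (subst card_Un_disjoint) auto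
      also have "\<dots> \<le> card (R `` (T \<union> S))"
        using psubset.prems(2)[of "T \<union> S"] T 3(1) by auto
      also have "R `` (T \<union> S) = R' `` T \<union> R `` S" unfolding R'_def by auto
      also have "card \<dots> \<le> card (R' `` T) + card (R `` S)" by (rule card_Un_le)
      finally show "card T \<le> card (R' `` T)" using 3(3) by simp
    qed
    then obtain f2 where f2: "inj_on f2 (A - S)" "\<And>x. x \<in> A - S \<Longrightarrow> (x, f2 x) \<in> R'" by blast
    define f where "f x = (if x \<in> S then f1 x else f2 x)" for x
    have "inj_on f A"
    proof (rule inj_onI)
      fix x y assume xy: "x \<in> A" "y \<in> A" "f x = f y"
      have f1_im: "f1 z \<in> R `` S" if "z \<in> S" for z using f1(2) that by blast
      have f2_im: "f2 z \<notin> R `` S" if "z \<in> A - S" for z using f2(2)[OF that] by (simp add: R'_def)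
      have "x \<in> S \<longleftrightarrow> y \<in> S"
        using f1_im[of x] f1_im[of y] f2_im[of x] f2_im[of y] xy unfolding f_def
        by (metis DiffI)
      then show "x = y"
        using xy f1(1) f2(1) by (cases "x \<in> S") (auto simp: f_def inj_on_def)
    qed
    moreover have "\<forall>x\<in>A. (x, f x) \<in> R"
      using f1(2) f2(2) unfolding f_def R'_def by auto
    ultimately show ?thesis by blast
  qed
qed

text \<open>Take \<open>A'\<close> of least size among the nonempty subsets with at most as many
  neighbours as elements. Its nonempty proper subsets have a surplus, which gives Hall's condition,
  and by counting the matching covers the whole neighbourhood.\<close>

lemma ex_perfect_matching:
  assumes "finite A" "A \<noteq> {}" "finite R" "card (R `` A) \<le> card A"
    and "\<And>x. x \<in> A \<Longrightarrow> R `` {x} \<noteq> {}"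
  shows "\<exists>A' f. A' \<subseteq> A \<and> A' \<noteq> {} \<and> bij_betw f A' (R `` A') \<and> (\<forall>x\<in>A'. (x, f x) \<in> R)"
proof -
  define Q where "Q S \<longleftrightarrow> S \<subseteq> A \<and> S \<noteq> {} \<and> card (R `` S) \<le> card S" for S
  have "Q A" using assms by (simp add: Q_def)
  then obtain A' where A': "Q A'" "\<And>S. Q S \<Longrightarrow> card A' \<le> card S"
    by (metis arg_min_nat_lemma)
  have finA': "finite A'" using A'(1) assms(1) finite_subset Q_def by blast
  have finI: "finite (R `` S)" for S
    using assms(3) by (rule finite_Image)
  have proper: "card S < card (R `` S)" if "S \<subset> A'" "S \<noteq> {}" for S
  proof (rule ccontr)
    assume "\<not> card S < card (R `` S)"
    then have "Q S" using that A'(1) by (auto simp: Q_def)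
    then show False using A'(2) psubset_card_mono[OF finA' that(1)] by fastforce
  qed
  \<comment> \<open>Either \<open>A'\<close> is a single vertex with a neighbour, or the surplus of
    \<open>A'\<close> without one vertex already provides \<open>card A'\<close> neighbours.\<close>
  have full: "card A' \<le> card (R `` A')"
  proof -
    obtain x where x: "x \<in> A'" using A'(1) by (auto simp: Q_def)
    show ?thesis
    proof (cases "A' = {x}")
      case True
      then have "R `` A' \<noteq> {}" using assms(5) A'(1) by (auto simp: Q_def)
      then show ?thesis using True finI by (simp add: Suc_leI card_gt_0_iff)
    next
      case False
      then have "card (A' - {x}) < card (R `` (A' - {x}))"
        using x by (intro proper) auto
      also have "\<dots> \<le> card (R `` A')" by (intro card_mono finI) auto
      finally show ?thesis using x finA' by simp
    qed
  qed
  have "\<exists>f. inj_on f A' \<and> (\<forall>x\<in>A'. (x, f x) \<in> R)"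
  proof (rule hall_marriage[OF finA' assms(3)])
    show "card S \<le> card (R `` S)" if "S \<subseteq> A'" for S
      using that full proper[of S] by (metis card.empty le0 less_imp_le psubsetI)
  qed
  then obtain f where f: "inj_on f A'" "\<And>x. x \<in> A' \<Longrightarrow> (x, f x) \<in> R" by blast
  have "f ` A' = R `` A'"
  proof (rule card_seteq[OF finI])
    show "f ` A' \<subseteq> R `` A'" using f(2) by auto
    show "card (R `` A') \<le> card (f ` A')"
      using A'(1) f(1) by (simp add: Q_def card_image)
  qed
  with f A'(1) show ?thesis unfolding Q_def bij_betw_def by blast
qed

section \<open>Large unions of nested matchings\<close>

text \<open>Only degrees in \<open>A\<close> are bounded, since these survive the passage to
  \<open>A'\<close> and its neighbourhood, whereas vertices of \<open>B\<close> may lose neighbours.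
  Segments \<open>{..<j}\<close> starting at 0 leave room for one more matching below after a shift
  of colours.\<close>

lemma nested_matchings:
  fixes E :: "'a set set"
  assumes "finite A" "finite B" "A \<inter> B = {}" "A \<noteq> {}" "card B \<le> card A"
    and "\<And>x. x \<in> A \<Longrightarrow> d \<le> card {y \<in> B. {x, y} \<in> E}"
  shows "\<exists>F c. F \<subseteq> E \<and> finite F \<and> \<Union>F \<subseteq> A \<union> B \<and> d\<^sup>2 \<le> 2 * card F \<and>
    (\<forall>v. \<exists>j::nat. bij_betw c {e \<in> F. v \<in> e} {..<j})"
  using assms
proof (induction d arbitrary: A B E)
  case 0
  have "\<forall>v. \<exists>j. bij_betw (\<lambda>_. 0) {e \<in> {} :: 'a set set. v \<in> e} {..<j :: nat}"
    by (intro allI exI[of _ 0]) (simp add: bij_betw_def)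
  then show ?case by (intro exI[of _ "{}"] exI[of _ "\<lambda>_. 0"]) simp
next
  case (Suc d)
  define R where "R = {(x, y). x \<in> A \<and> y \<in> B \<and> {x, y} \<in> E}"
  have "R \<subseteq> A \<times> B" by (auto simp: R_def)
  then have finR: "finite R" using Suc.prems(1,2) finite_subset by blast
  have R1: "R `` {x} = {y \<in> B. {x, y} \<in> E}" if "x \<in> A" for x
    using that by (auto simp: R_def)
  have "card (R `` A) \<le> card B"
    by (intro card_mono Suc.prems) (auto simp: R_def)
  then have le: "card (R `` A) \<le> card A" using Suc.prems by simp
  have "R `` {x} \<noteq> {}" if "x \<in> A" for x
    using Suc.prems(6)[OF that] R1[OF that] by (metis card.empty not_less_eq_eq le0)
  from ex_perfect_matching[OF Suc.prems(1,4) finR le this]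
  obtain A' f where A': "A' \<subseteq> A" "A' \<noteq> {}" "bij_betw f A' (R `` A')"
    "\<And>x. x \<in> A' \<Longrightarrow> (x, f x) \<in> R" by blast
  define B' where "B' = R `` A'"
  define M where "M = (\<lambda>x. {x, f x}) ` A'"
  have B'B: "B' \<subseteq> B" by (auto simp: B'_def R_def)
  have fin: "finite A'" "finite B'"
    using A'(1) B'B Suc.prems(1,2) finite_subset by blast+
  have disj: "A' \<inter> B' = {}" using Suc.prems(3) A'(1) B'B by blast
  have fB': "f x \<in> B'" if "x \<in> A'" for x using A'(4)[OF that] that by (auto simp: B'_def)
  have f_inj: "inj_on f A'" and f_im: "f ` A' = B'"
    using A'(3) by (auto simp: bij_betw_def B'_def)
  have card_eq: "card B' = card A'" using A'(3) by (simp add: bij_betw_same_card B'_def)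
  \<comment> \<open>\<open>B'\<close> is the full neighbourhood of \<open>A'\<close>, so shrinking
    \<open>B\<close> to \<open>B'\<close> loses no neighbour of a vertex in
    \<open>A'\<close>.\<close>
  have nb: "{y \<in> B'. {x, y} \<in> E} = {y \<in> B. {x, y} \<in> E}" if "x \<in> A'" for x
    using that A'(1) by (auto simp: B'_def R_def)
  have "d \<le> card {y \<in> B'. {x, y} \<in> E - M}" if x: "x \<in> A'" for x
  proof -
    have "{y \<in> B'. {x, y} \<in> E - M} = {y \<in> B. {x, y} \<in> E} - {f x}"
    proof -
      have "{x, y} \<in> M \<longleftrightarrow> y = f x" if "y \<in> B'" for y
        using that x disj fB' by (auto simp: M_def doubleton_eq_iff)
      then show ?thesis using nb[OF x] by auto
    qed
    moreover have "Suc d \<le> card {y \<in> B. {x, y} \<in> E}" using Suc.prems(6) x A'(1) by blast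
    ultimately show ?thesis
      using diff_card_le_card_Diff[of "{f x}" "{y \<in> B. {x, y} \<in> E}"] by simp
  qed
  from Suc.IH[OF fin disj A'(2) _ this] card_eq
  obtain F c where F: "F \<subseteq> E - M" "finite F" "\<Union>F \<subseteq> A' \<union> B'" "d\<^sup>2 \<le> 2 * card F"
    and c: "\<And>v. \<exists>j::nat. bij_betw c {e \<in> F. v \<in> e} {..<j}"
    by auto
  have ME: "M \<subseteq> E" using A'(4) by (auto simp: M_def R_def)
  have finM: "finite M" using fin by (simp add: M_def)
  have "inj_on (\<lambda>x. {x, f x}) A'"
    using disj fB' by (auto simp: inj_on_def doubleton_eq_iff)
  then have cardM: "card M = card A'" by (simp add: M_def card_image)
  obtain x0 where x0: "x0 \<in> A'" using A'(2) by blast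
  have "Suc d \<le> card {y \<in> B'. {x0, y} \<in> E}"
    using Suc.prems(6)[of x0] x0 A'(1) nb[OF x0] by auto
  also have "\<dots> \<le> card B'" by (intro card_mono fin) auto
  finally have big: "Suc d \<le> card M" using cardM card_eq by simp
  \<comment> \<open>The size bound follows from
    \<open>d\<^sup>2 + 2 * Suc d \<ge> (Suc d)\<^sup>2\<close>.\<close>
  have "card (M \<union> F) = card M + card F"
    using F finM by (intro card_Un_disjoint) auto
  with big F(4) have size: "(Suc d)\<^sup>2 \<le> 2 * card (M \<union> F)"
    by (simp add: power2_eq_square)
  \<comment> \<open>The new matching takes colour 0 and the old colours move up by one. All edges of
    \<open>F\<close> lie within \<open>A' \<union> B'\<close>, where every vertex meets exactly one
    edge of \<open>M\<close>, so initial segments stay initial segments.\<close>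
  define c' where "c' e = (if e \<in> M then 0 else Suc (c e))" for e
  have "\<exists>j. bij_betw c' {e \<in> M \<union> F. v \<in> e} {..<j}" for v
  proof (cases "v \<in> A' \<union> B'")
    case False
    then have "{e \<in> M \<union> F. v \<in> e} = {}" using F(3) fB' by (auto simp: M_def)
    then show ?thesis by (intro exI[of _ 0]) (simp only: lessThan_0 bij_betw_def, simp)
  next
    case True
    have "\<exists>m. {e \<in> M. v \<in> e} = {m}"
    proof -
      have "\<exists>x\<in>A'. v = x \<or> v = f x" using True f_im by blast
      then obtain x where x: "x \<in> A'" "v = x \<or> v = f x" by blast
      have "{e \<in> M. v \<in> e} = {{x, f x}}"
        using x disj fB' f_inj by (auto simp: M_def inj_on_def)
      then show ?thesis by blast
    qed
    then obtain m where m: "{e \<in> M. v \<in> e} = {m}" by blast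
    obtain j where j: "bij_betw c {e \<in> F. v \<in> e} {..<j}" using c by blast
    have "bij_betw (Suc \<circ> c) {e \<in> F. v \<in> e} (Suc ` {..<j})"
      using j by (intro bij_betw_trans) (auto simp: bij_betw_def)
    moreover have "bij_betw (Suc \<circ> c) {e \<in> F. v \<in> e} (Suc ` {..<j}) \<longleftrightarrow>
      bij_betw c' {e \<in> F. v \<in> e} (Suc ` {..<j})"
      by (rule bij_betw_cong) (use F(1) in \<open>auto simp: c'_def\<close>)
    moreover have "bij_betw c' {m} {0}" using m by (auto simp: c'_def bij_betw_def)
    ultimately have "bij_betw c' ({m} \<union> {e \<in> F. v \<in> e}) ({0} \<union> Suc ` {..<j})"
      by (intro bij_betw_combine) auto
    moreover have "{e \<in> M \<union> F. v \<in> e} = {m} \<union> {e \<in> F. v \<in> e}" using m by auto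
    moreover have "{0} \<union> Suc ` {..<j} = {..<Suc j}"
      by (simp add: lessThan_Suc_eq_insert_0)
    ultimately show ?thesis by metis
  qed
  moreover have "\<Union>(M \<union> F) \<subseteq> A \<union> B" using F(3) A'(1) B'B fB' by (fastforce simp: M_def)
  moreover have "M \<union> F \<subseteq> E" using ME F(1) by auto
  ultimately show ?case using size finM F(2) by (intro exI[of _ "M \<union> F"] exI[of _ c']) auto
qed

lemma icol_if_initial_segments:
  fixes c :: "'a set \<Rightarrow> nat"
  assumes "\<And>v. \<exists>j. bij_betw c {e \<in> F. v \<in> e} {..<j}"
  shows "icol F"
proof -
  have "\<exists>a b. bij_betw (int \<circ> c) {e \<in> F. v \<in> e} {a..b}" for v
  proof -
    obtain j where j: "bij_betw c {e \<in> F. v \<in> e} {..<j}" using assms by blast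
    have "int ` {..<j} = {0..int j - 1}"
      by (auto simp: image_iff) (metis lessThan_iff nat_0_le nat_less_iff zless_nat_eq_int_zless)
    then have "bij_betw int {..<j} {0..int j - 1}" by (auto simp: bij_betw_def)
    with j show ?thesis by (blast intro: bij_betw_trans)
  qed
  then show ?thesis unfolding icol_def by blast
qed

section \<open>Bipartite subgraphs from a maximum cut\<close>

text \<open>In a partition minimising the number \<open>inner\<close> of uncut edges, each vertex
  has at least half of its edges in the cut.\<close>

lemma ex_unfriendly_partition:
  assumes "finite W" "finite E" "\<And>e. e \<in> E \<Longrightarrow> card e = 2"
    and "\<And>w. w \<in> W \<Longrightarrow> 2 * d \<le> card {e \<in> E. e \<subseteq> W \<and> w \<in> e}"
  shows "\<exists>A\<subseteq>W. card (W - A) \<le> card A \<and> (\<forall>x\<in>A. d \<le> card {y \<in> W - A. {x, y} \<in> E})"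
proof -
  define inner where "inner A = card {e \<in> E. e \<subseteq> A} + card {e \<in> E. e \<subseteq> W - A}" for A
  obtain A0 where A0: "A0 \<subseteq> W" "\<And>A. A \<subseteq> W \<Longrightarrow> inner A0 \<le> inner A"
    using arg_min_nat_lemma[of "\<lambda>A. A \<subseteq> W" "{}" inner] by blast
  \<comment> \<open>Exchanging the two sides preserves \<open>inner\<close>, so the larger side may
    be called \<open>A\<close>.\<close>
  define A where "A = (if card (W - A0) \<le> card A0 then A0 else W - A0)"
  have AW: "A \<subseteq> W" using A0 by (auto simp: A_def)
  have "W - (W - A0) = A0" using A0 by auto
  then have "inner A = inner A0" by (auto simp: inner_def A_def)
  then have min: "inner A \<le> inner A'" if "A' \<subseteq> W" for A' using A0 that by simp
  have bal: "card (W - A) \<le> card A"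
    using A0 \<open>W - (W - A0) = A0\<close> by (auto simp: A_def)
  have "d \<le> card {y \<in> W - A. {x, y} \<in> E}" if x: "x \<in> A" for x
  proof -
    let ?B = "W - A"
    define I where "I = {e \<in> E. e \<subseteq> A \<and> x \<in> e}"
    define O' where "O' = {e \<in> E. e \<subseteq> insert x ?B \<and> x \<in> e}"
    have fin: "finite {e \<in> E. Q e}" for Q using assms(2) by simp
    have "{e \<in> E. e \<subseteq> A} = {e \<in> E. e \<subseteq> A - {x}} \<union> I" by (auto simp: I_def)
    then have 1: "card {e \<in> E. e \<subseteq> A} = card {e \<in> E. e \<subseteq> A - {x}} + card I"
      by (simp only:) (rule card_Un_disjoint; use assms(2) in \<open>auto simp: I_def\<close>)
    have "W - (A - {x}) = insert x ?B" using x AW by auto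
    then have "{e \<in> E. e \<subseteq> W - (A - {x})} = {e \<in> E. e \<subseteq> ?B} \<union> O'"
      using x by (auto simp: O'_def)
    then have 2: "card {e \<in> E. e \<subseteq> W - (A - {x})} = card {e \<in> E. e \<subseteq> ?B} + card O'"
      by (simp only:) (rule card_Un_disjoint; use assms(2) x in \<open>auto simp: O'_def\<close>)
    \<comment> \<open>Moving \<open>x\<close> across cuts the edges of \<open>I\<close> and uncuts
      those of \<open>O'\<close>; minimality forbids a gain.\<close>
    have "inner A \<le> inner (A - {x})" using AW by (intro min) auto
    then have IO: "card I \<le> card O'" using 1 2 by (simp add: inner_def)
    have "{e \<in> E. e \<subseteq> W \<and> x \<in> e} \<subseteq> I \<union> O'"
    proof
      fix e assume e: "e \<in> {e \<in> E. e \<subseteq> W \<and> x \<in> e}"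
      then obtain y where "e = {x, y}"
        using assms(3)[of e] by (auto simp: card_2_iff)
      then show "e \<in> I \<union> O'" using e x by (auto simp: I_def O'_def)
    qed
    then have "card {e \<in> E. e \<subseteq> W \<and> x \<in> e} \<le> card (I \<union> O')"
      using fin by (intro card_mono) (auto simp: I_def O'_def)
    then have "2 * d \<le> card I + card O'"
      using assms(4)[of x] x AW card_Un_le[of I O'] by fastforce
    with IO have "d \<le> card O'" by simp
    also have "O' \<subseteq> (\<lambda>y. {x, y}) ` {y \<in> ?B. {x, y} \<in> E}"
    proof
      fix e assume e: "e \<in> O'"
      then have "card e = 2" "x \<in> e" using assms(3) by (auto simp: O'_def)
      then obtain y where "e = {x, y}" "y \<noteq> x"
        by (auto simp: card_2_iff)
      then show "e \<in> (\<lambda>y. {x, y}) ` {y \<in> ?B. {x, y} \<in> E}"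
        using e by (auto simp: O'_def)
    qed
    then have "card O' \<le> card {y \<in> ?B. {x, y} \<in> E}"
      using assms(1) by (intro surj_card_le) auto
    finally show ?thesis .
  qed
  with AW bal show ?thesis by blast
qed

section \<open>Repeated removal of nested matchings\<close>

text \<open>Here \<open>t\<close> counts the removed subgraphs; each has at least half of
  \<open>d\<^sup>2\<close> edges, and the \<open>2 * d\<close> further classes come from the
  degenerate remainder.\<close>

lemma ex_decomposable:
  assumes "finite V" "E \<subseteq> nsets V 2" "0 < d"
  shows "\<exists>t. t * d\<^sup>2 \<le> 2 * card E \<and> decomposable E (2 * d + t)"
  using assms(2)
proof (induction "card E" arbitrary: E rule: less_induct)
  case less
  have finE: "finite E"
    using assms(1) less.prems by (meson finite_imp_finite_nsets finite_subset)
  show ?case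
  proof (cases "\<forall>W\<subseteq>V. W \<noteq> {} \<longrightarrow> (\<exists>w\<in>W. card {e \<in> E. e \<subseteq> W \<and> w \<in> e} \<le> 2 * d)")
    case True
    then have "decomposable E (2 * d)"
      using assms(1) less.prems by (intro decomposable_if_degenerate[of V]) auto
    then show ?thesis by (intro exI[of _ 0]) simp
  next
    case False
    then obtain W where W: "W \<subseteq> V" "W \<noteq> {}"
      "\<And>w. w \<in> W \<Longrightarrow> 2 * d \<le> card {e \<in> E. e \<subseteq> W \<and> w \<in> e}"
      by (meson nat_le_linear)
    have finW: "finite W" using W(1) assms(1) finite_subset by blast
    have "card e = 2" if "e \<in> E" for e using that less.prems by (auto simp: nsets_def)
    from ex_unfriendly_partition[OF finW finE this W(3)]
    obtain A where A: "A \<subseteq> W" "card (W - A) \<le> card A"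
      "\<And>x. x \<in> A \<Longrightarrow> d \<le> card {y \<in> W - A. {x, y} \<in> E}" by blast
    have "A \<noteq> {}" using A(2) W(2) finW by auto
    have fins: "finite A" "finite (W - A)" using finW A(1) finite_subset by blast+
    obtain F and c :: "'a set \<Rightarrow> nat" where F: "F \<subseteq> E" "finite F" "d\<^sup>2 \<le> 2 * card F"
      "\<And>v. \<exists>j. bij_betw c {e \<in> F. v \<in> e} {..<j}"
      using nested_matchings[OF fins _ \<open>A \<noteq> {}\<close> A(2,3)] by blast
    from F(4) have "icol F" by (rule icol_if_initial_segments)
    \<comment> \<open>As \<open>d > 0\<close>, the removed subgraph has an edge, so the induction on
      the number of edges advances.\<close>
    have "card F > 0" using F(3) assms(3) by (auto intro!: Nat.gr0I)
    have cardE: "card E = card (E - F) + card F"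
      using F(1,2) finE by (simp add: card_Diff_subset card_mono)
    then obtain t where t: "t * d\<^sup>2 \<le> 2 * card (E - F)" "decomposable (E - F) (2 * d + t)"
      using less.hyps[of "E - F"] less.prems \<open>card F > 0\<close> by auto
    have "decomposable (E - F \<union> F) (Suc (2 * d + t))"
      by (rule decomposable_Un[OF t(2) \<open>icol F\<close>]) auto
    moreover have "E - F \<union> F = E" using F(1) by auto
    ultimately show ?thesis using t(1) F(3) cardE
      by (intro exI[of _ "Suc t"]) (simp add: algebra_simps)
  qed
qed

section \<open>Choice of the degree and asymptotics\<close>

text \<open>The exponent \<open>2/3\<close> balances the \<open>2 * d\<close> classes of the
  degenerate part against the at most \<open>n\<^sup>2 / d\<^sup>2\<close> removed
  subgraphs.\<close>

lemma interval_thickness_bound: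
  assumes "simple_graph V E" "card V = n" "n \<ge> 1"
  shows "real (interval_thickness V E) \<le> 5 * real n powr (2/3)"
proof -
  define x where "x = real n powr (2/3)"
  define d where "d = nat \<lceil>x\<rceil>"
  have x: "x \<ge> 1" using assms(3) unfolding x_def by (simp add: ge_one_powr_ge_zero)
  have d: "real d \<ge> x" "real d \<le> x + 1" "d > 0"
    using x unfolding d_def by linarith+
  have V: "finite V" "E \<subseteq> nsets V 2" using assms(1) by (auto simp: simple_graph_def)
  obtain t where t: "t * d\<^sup>2 \<le> 2 * card E" "decomposable E (2 * d + t)"
    using ex_decomposable[OF V d(3)] by blast
  have "card E \<le> n choose 2"
    using card_mono[OF finite_imp_finite_nsets[OF V(1)] V(2)] assms(2) by simp
  then have "2 * card E \<le> n * (n - 1)" by (simp add: choose_two)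
  also have "\<dots> \<le> n * n" by simp
  finally have "2 * card E \<le> n * n" .
  with t(1) have "t * d\<^sup>2 \<le> n\<^sup>2" by (simp add: power2_eq_square)
  then have "real t * (real d)\<^sup>2 \<le> (real n)\<^sup>2"
    by (metis of_nat_le_iff of_nat_mult of_nat_power)
  moreover have "real t * x\<^sup>2 \<le> real t * (real d)\<^sup>2"
    using d x by (intro mult_left_mono power_mono) auto
  moreover have "(real n)\<^sup>2 = x * x\<^sup>2"
  proof -
    have "x * x\<^sup>2 = x ^ 3" by (simp add: power3_eq_cube power2_eq_square)
    also have "\<dots> = real n powr 2"
      using assms(3) unfolding x_def by (subst powr_power) auto
    also have "\<dots> = (real n)\<^sup>2"
      using assms(3) by (simp add: powr_numeral)
    finally show ?thesis by simp
  qed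
  ultimately have "real t * x\<^sup>2 \<le> x * x\<^sup>2" by linarith
  then have "real t \<le> x" using x by (simp add: mult_le_cancel_right)
  moreover have "interval_thickness V E \<le> 2 * d + t"
    using t(2) by (rule interval_thickness_le)
  then have "real (interval_thickness V E) \<le> 2 * real d + real t"
    by (metis of_nat_add of_nat_le_iff of_nat_mult of_nat_numeral)
  \<comment> \<open>Altogether \<open>2 * d + t \<le> 2 * (x + 1) + x \<le> 5 * x\<close>, since
    \<open>x \<ge> 1\<close>.\<close>
  ultimately show ?thesis using d x unfolding x_def by linarith
qed

text \<open>For \<open>n > 1\<close> the factor 5 is absorbed as
  \<open>n powr (ln 5 / ln n)\<close>. For \<open>n \<le> 1\<close> there are no edges, so the
  thickness is 0 whatever value the exponent takes.\<close>

lemma interval_thickness_le_powr: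
  assumes "simple_graph V E" "card V = n"
  shows "real (interval_thickness V E) \<le> real n powr (8/9 + ln 5 / ln (real n))"
proof (cases "n \<le> 1")
  case True
  have V: "finite V" "E \<subseteq> nsets V 2" using assms(1) by (auto simp: simple_graph_def)
  have "e \<notin> E" for e
  proof
    assume "e \<in> E"
    then have "e \<subseteq> V" "card e = 2" using V by (auto simp: nsets_def)
    then show False using card_mono[OF V(1), of e] True assms(2) by simp
  qed
  then have "E = {}" by blast
  then have "decomposable E 0" by (simp add: decomposable_def icol_empty)
  then have "interval_thickness V E \<le> 0" by (rule interval_thickness_le)
  then show ?thesis by simp
next
  case False
  then have n: "real n > 1" by simp
  have "real (interval_thickness V E) \<le> 5 * real n powr (2/3)"
    using interval_thickness_bound[OF assms] False by simp
  also have "\<dots> \<le> 5 * real n powr (8/9)"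
    using n by (simp add: powr_mono)
  also have "5 = real n powr (ln 5 / ln (real n))"
    using n by (simp add: powr_def)
  finally show ?thesis by (simp add: powr_add mult.commute)
qed

theorem theorem1p2:
  shows "\<exists>f :: nat \<Rightarrow> real. f \<longlonglongrightarrow> 0 \<and>
    (\<forall>n. real (max_interval_thickness n) \<le> real n powr (8/9 + f n)) \<and>
    (\<forall>n (V :: 'a set) E. simple_graph V E \<and> card V = n \<longrightarrow>
       real (interval_thickness V E) \<le> real n powr (8/9 + f n))"
proof (intro exI[of _ "\<lambda>n. ln 5 / ln (real n)"] conjI allI impI)
  show "(\<lambda>n. ln 5 / ln (real n)) \<longlonglongrightarrow> 0"
    by (intro tendsto_divide_0[OF tendsto_const] filterlim_at_top_imp_at_infinity
        filterlim_compose[OF ln_at_top] filterlim_real_sequentially)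
  fix n :: nat
  let ?b = "real n powr (8/9 + ln 5 / ln (real n))"
  let ?S = "{interval_thickness V E | (V :: nat set) E. simple_graph V E \<and> card V = n}"
  \<comment> \<open>The bound itself makes \<open>?S\<close> finite, and the edgeless graph makes it
    nonempty, so \<open>Max\<close> is attained by an actual graph.\<close>
  have "k \<le> nat \<lfloor>?b\<rfloor>" if "k \<in> ?S" for k
    using that interval_thickness_le_powr le_nat_floor by blast
  then have "?S \<subseteq> {..nat \<lfloor>?b\<rfloor>}" by blast
  then have "finite ?S" using finite_subset by blast
  moreover have "simple_graph {..<n} {}" by (simp add: simple_graph_def)
  then have "interval_thickness {..<n} {} \<in> ?S" by force
  then have "?S \<noteq> {}" by blast
  ultimately have "max_interval_thickness n \<in> ?S"
    unfolding max_interval_thickness_def by (rule Max_in)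
  then show "real (max_interval_thickness n) \<le> ?b"
    using interval_thickness_le_powr by fastforce
  fix V :: "'a set" and E
  assume "simple_graph V E \<and> card V = n"
  then show "real (interval_thickness V E) \<le> ?b"
    using interval_thickness_le_powr by blast
qed

end
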